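(* Let $e\in\mathbb{C}$ with $|e|=1$ and let $\rho_1,\rho_2\in(0,1)$. If $f\in L([a,b];\mathbb{C})$ is such that $$|f(t)-e|\le\rho_1,\qquad |f(t)-ie|\le\rho_2\qquad\text{for a.e. }t\in[a,b],$$ then $$\sqrt{2-\rho_1^2-\rho_2^2}\int_a^b|f(t)|\,dt\le\left|\int_a^b f(t)\,dt\right|,$$ with equality if and only if $$\int_a^b f(t)\,dt=\left(\sqrt{1-\rho_1^2}+i\sqrt{1-\rho_2^2}\right)\left(\int_a^b|f(t)|\,dt\right) e.$$
   Context: $L([a,b];\mathbb{C})$ denotes the set of Lebesgue integrable functions $f:[a,b]\to\mathbb{C}$. $i$ is the imaginary unit. *)

theory Defs
  imports "HOL-Analysis.Analysis"
begin

end

theory Submission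
  imports Defs
begin

text \<open>Expanding norm (z - u) squared for a unit vector u gives
  2 * inner z u >= norm z squared + (1 - rho squared), and AM-GM bounds the right-hand side below by
  2 * sqrt (1 - rho squared) * norm z. Integrating this for u = e and u = i e bounds the real and
  imaginary parts of (cnj e) times the integral of f, which yields both the inequality and its
  equality case.\<close>

lemma norm_le_inner_unit:
  fixes u z :: "'a::real_inner"
  assumes "norm u = 1" and "norm (z - u) \<le> \<rho>" and "\<rho> < 1"
  shows "sqrt (1 - \<rho>\<^sup>2) * norm z \<le> inner z u"
proof -
  \<comment> \<open>Nonnegativity of \<rho> is forced by the norm bound; with \<rho> < 1 it gives
    \<rho> squared at most 1, so the square root squares back.\<close>
  have "0 \<le> \<rho>" using assms(2) norm_ge_zero order_trans by blast
  hence s: "(sqrt (1 - \<rho>\<^sup>2))\<^sup>2 = 1 - \<rho>\<^sup>2"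
    using assms(3) by (simp add: abs_square_le_1)
  have "(norm (z - u))\<^sup>2 = (norm z)\<^sup>2 - 2 * inner z u + 1"
    using assms(1) unfolding power2_norm_eq_inner norm_eq_1
    by (simp add: inner_diff inner_commute)
  moreover have "(norm (z - u))\<^sup>2 \<le> \<rho>\<^sup>2"
    using assms(2) by (simp add: power_mono)
  \<comment> \<open>This square is the AM-GM step; the two facts above bound the sum of its squared
    terms by \<open>2 * inner z u\<close>.\<close>
  moreover have "0 \<le> (norm z - sqrt (1 - \<rho>\<^sup>2))\<^sup>2" by simp
  ultimately show ?thesis
    using s by (simp add: power2_diff mult.commute)
qed

lemma integral_norm_le_inner_unit:
  fixes f :: "'a \<Rightarrow> 'b::{real_inner, banach, second_countable_topology}"
  assumes "norm u = 1" and "\<rho> < 1" and int: "integrable M f"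
    and ae: "AE t in M. norm (f t - u) \<le> \<rho>"
  shows "sqrt (1 - \<rho>\<^sup>2) * (LINT t|M. norm (f t)) \<le> inner (LINT t|M. f t) u"
proof -
  have "(LINT t|M. sqrt (1 - \<rho>\<^sup>2) * norm (f t)) \<le> (LINT t|M. inner (f t) u)"
    using int ae norm_le_inner_unit[OF assms(1) _ assms(2)]
    by (intro integral_mono_AE) auto
  thus ?thesis using int by simp
qed

text \<open>Squaring is monotone on nonnegative reals, so the coordinate bounds add up to a bound on
  the modulus. The second part supplies the equality case of the theorem.\<close>

lemma norm_ge_of_Re_Im_ge:
  fixes z :: complex
  assumes "0 \<le> x" "0 \<le> y" "x \<le> Re z" "y \<le> Im z"
  shows "sqrt (x\<^sup>2 + y\<^sup>2) \<le> norm z"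
    and "sqrt (x\<^sup>2 + y\<^sup>2) = norm z \<longleftrightarrow> z = Complex x y"
proof -
  have le: "x\<^sup>2 \<le> (Re z)\<^sup>2" "y\<^sup>2 \<le> (Im z)\<^sup>2"
    using assms by (simp_all add: power_mono)
  thus "sqrt (x\<^sup>2 + y\<^sup>2) \<le> norm z"
    unfolding cmod_def by simp
  \<comment> \<open>Two termwise inequalities can sum to an equality only if each is an
    equality.\<close>
  have "sqrt (x\<^sup>2 + y\<^sup>2) = norm z \<longleftrightarrow> x\<^sup>2 = (Re z)\<^sup>2 \<and> y\<^sup>2 = (Im z)\<^sup>2"
    unfolding cmod_def using le by auto
  \<comment> \<open>Both coordinates of \<open>z\<close> are nonnegative, so equal squares leave no
    sign ambiguity.\<close>
  also have "\<dots> \<longleftrightarrow> z = Complex x y"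
    using assms by (auto simp: complex_eq_iff)
  finally show "sqrt (x\<^sup>2 + y\<^sup>2) = norm z \<longleftrightarrow> z = Complex x y" .
qed

theorem proposition2:
  fixes e :: complex and \<rho>1 \<rho>2 a b :: real and f :: "real \<Rightarrow> complex"
  assumes "norm e = 1"
    and "\<rho>1 \<in> {0<..<1}" and "\<rho>2 \<in> {0<..<1}"
    and "a \<le> b"
    and "integrable (lebesgue_on {a..b}) f"
    and "AE t in lebesgue_on {a..b}. norm (f t - e) \<le> \<rho>1 \<and> norm (f t - \<i> * e) \<le> \<rho>2"
  shows "sqrt (2 - \<rho>1\<^sup>2 - \<rho>2\<^sup>2) * (LINT t|lebesgue_on {a..b}. norm (f t))
           \<le> norm (LINT t|lebesgue_on {a..b}. f t)
    \<and> (sqrt (2 - \<rho>1\<^sup>2 - \<rho>2\<^sup>2) * (LINT t|lebesgue_on {a..b}. norm (f t))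
           = norm (LINT t|lebesgue_on {a..b}. f t)
        \<longleftrightarrow> (LINT t|lebesgue_on {a..b}. f t)
           = (complex_of_real (sqrt (1 - \<rho>1\<^sup>2)) + \<i> * complex_of_real (sqrt (1 - \<rho>2\<^sup>2)))
               * complex_of_real (LINT t|lebesgue_on {a..b}. norm (f t)) * e)"
proof -
  define I where "I = (LINT t|lebesgue_on {a..b}. f t)"
  define N where "N = (LINT t|lebesgue_on {a..b}. norm (f t))"
  define s1 where "s1 = sqrt (1 - \<rho>1\<^sup>2)"
  define s2 where "s2 = sqrt (1 - \<rho>2\<^sup>2)"
  \<comment> \<open>Rotation by \<open>cnj e\<close> carries the directions \<open>e\<close> and
    \<open>\<i> * e\<close> to the real and imaginary axes, so the two inner products with
    \<open>I\<close> become \<open>Re J\<close> and \<open>Im J\<close>.\<close>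
  define J where "J = I * cnj e"
  have N0: "0 \<le> N" unfolding N_def by simp
  have sq: "s1\<^sup>2 = 1 - \<rho>1\<^sup>2" "s2\<^sup>2 = 1 - \<rho>2\<^sup>2" "0 \<le> s1" "0 \<le> s2"
    using assms(2,3) unfolding s1_def s2_def by (simp_all add: abs_square_le_1)
  have "norm (\<i> * e) = 1" using assms(1) by (simp add: norm_mult)
  hence "s1 * N \<le> inner I e" "s2 * N \<le> inner I (\<i> * e)"
    unfolding s1_def s2_def N_def I_def using assms
    by (auto intro!: integral_norm_le_inner_unit)
  hence ReIm: "s1 * N \<le> Re J" "s2 * N \<le> Im J"
    unfolding J_def by (simp_all add: inner_complex_def algebra_simps)
  \<comment> \<open>The constant under the root in the theorem is the sum of the squares of
    \<open>s1\<close> and \<open>s2\<close>.\<close>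
  have "(s1 * N)\<^sup>2 + (s2 * N)\<^sup>2 = (2 - \<rho>1\<^sup>2 - \<rho>2\<^sup>2) * N\<^sup>2"
    by (simp add: power_mult_distrib sq algebra_simps)
  hence lhs: "sqrt ((s1 * N)\<^sup>2 + (s2 * N)\<^sup>2) = sqrt (2 - \<rho>1\<^sup>2 - \<rho>2\<^sup>2) * N"
    using N0 by (simp add: real_sqrt_mult)
  have normJ: "norm J = norm I" unfolding J_def by (simp add: norm_mult assms(1))
  have ee: "e * cnj e = 1"
    using complex_norm_square[of e] assms(1) by simp
  have C: "Complex (s1 * N) (s2 * N) = (of_real s1 + \<i> * of_real s2) * of_real N"
    by (simp add: complex_eq_iff)
  \<comment> \<open>Since \<open>cnj e\<close> is the inverse of \<open>e\<close>, the rotation can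
    be undone, which turns the equality condition on \<open>J\<close> into the one on
    \<open>I\<close>.\<close>
  have "J = w \<longleftrightarrow> I = w * e" for w
    unfolding J_def using ee by (metis mult.assoc mult.commute mult_1_right)
  with norm_ge_of_Re_Im_ge[OF _ _ ReIm] N0 sq(3,4)
  show ?thesis
    unfolding lhs normJ C s1_def[symmetric] s2_def[symmetric]
      I_def[symmetric] N_def[symmetric] by simp
qed

end
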